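(* Let $\varphi=(1+\sqrt5)/2$. For all integers $t\ge1$ and $n\ge3t+2\lceil\varphi t\rceil$, \[ f(n,t)\le 2\min_{p\in\{\lfloor\varphi t\rfloor,\lceil\varphi t\rceil\}} p\max\{t^2,(p+t)(2t-p)\} \le(1+\sqrt5)t^3+\left(1+\frac1{\sqrt5}\right)t^2 . \]
   Context: All graphs are finite and simple. $\mathcal{G}_3(n)$ denotes the family of tripartite graphs with $n$ vertices in each of the three parts (each part is an independent set). $\delta(G)$ is the minimum degree of $G$ and $\tau(G)$ is the number of triangles in $G$. For integers $1\le t\le n$, \[ f(n,t)=\min\{\tau(G): G\in\mathcal{G}_3(n),\ \delta(G)\ge n+t\}. \] *)

theory Defs
  imports Complex_Main
begin

type_synonym 'a graph = "'a set \<times> 'a set set"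

abbreviation verts :: "'a graph \<Rightarrow> 'a set" where "verts G \<equiv> fst G"
abbreviation edges :: "'a graph \<Rightarrow> 'a set set" where "edges G \<equiv> snd G"

definition simple_graph :: "'a graph \<Rightarrow> bool" where
  "simple_graph G \<longleftrightarrow> finite (verts G) \<and> (\<forall>e \<in> edges G. e \<subseteq> verts G \<and> card e = 2)"

definition independent_in :: "'a graph \<Rightarrow> 'a set \<Rightarrow> bool" where
  "independent_in G A \<longleftrightarrow> (\<forall>x \<in> A. \<forall>y \<in> A. {x, y} \<notin> edges G)"

definition degree :: "'a graph \<Rightarrow> 'a \<Rightarrow> nat" where
  "degree G v = card {w \<in> verts G. {v, w} \<in> edges G}"

definition min_degree :: "'a graph \<Rightarrow> nat" where
  "min_degree G = Min (degree G ` verts G)"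

definition triangles :: "'a graph \<Rightarrow> 'a set set" where
  "triangles G = {T. T \<subseteq> verts G \<and> card T = 3 \<and>
     (\<forall>x \<in> T. \<forall>y \<in> T. x \<noteq> y \<longrightarrow> {x, y} \<in> edges G)}"

definition num_triangles :: "'a graph \<Rightarrow> nat" where
  "num_triangles G = card (triangles G)"

text \<open>The family of tripartite graphs with \<open>n\<close> vertices in each part. Vertices are natural
  numbers, which loses nothing: every finite graph is isomorphic to one of this kind.\<close>

definition tripartite_graphs :: "nat \<Rightarrow> nat graph set" where
  "tripartite_graphs n = {G. simple_graph G \<and>
     (\<exists>A B C. verts G = A \<union> B \<union> C \<and>
        A \<inter> B = {} \<and> A \<inter> C = {} \<and> B \<inter> C = {} \<and>
        card A = n \<and> card B = n \<and> card C = n \<and>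
        independent_in G A \<and> independent_in G B \<and> independent_in G C)}"

text \<open>Only meaningful for \<open>1 \<le> t \<le> n\<close>; there \<open>Min\<close> ranges over a finite nonempty set
  by the two lemmas below, so the minimum is attained.\<close>

definition min_triangles :: "nat \<Rightarrow> nat \<Rightarrow> nat" where
  "min_triangles n t = Min {num_triangles G | G. G \<in> tripartite_graphs n \<and> min_degree G \<ge> n + t}"

definition golden_ratio :: real where
  "golden_ratio = (1 + sqrt 5) / 2"

lemma finite_min_triangles_set:
  "finite {num_triangles G | G. G \<in> tripartite_graphs n \<and> min_degree G \<ge> n + t}"
proof (rule finite_subset)
  show "{num_triangles G | G. G \<in> tripartite_graphs n \<and> min_degree G \<ge> n + t} \<subseteq> {..2 ^ (3 * n)}"
  proof
    fix k
    assume "k \<in> {num_triangles G | G. G \<in> tripartite_graphs n \<and> min_degree G \<ge> n + t}"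
    then obtain V E where k: "k = num_triangles (V, E)" and G: "(V, E) \<in> tripartite_graphs n"
      by auto
    then obtain A B C where V: "V = A \<union> B \<union> C" and c: "card A = n" "card B = n" "card C = n"
      unfolding tripartite_graphs_def by auto
    have fin: "finite V" using G by (auto simp: tripartite_graphs_def simple_graph_def)
    have "card V \<le> 3 * n"
      unfolding V using card_Un_le[of "A \<union> B" C] card_Un_le[of A B] c by linarith
    have "num_triangles (V, E) \<le> card (Pow V)"
      unfolding num_triangles_def triangles_def by (rule card_mono) (use fin in auto)
    also have "\<dots> = 2 ^ card V" using fin by (simp add: card_Pow)
    also have "\<dots> \<le> 2 ^ (3 * n)" using \<open>card V \<le> 3 * n\<close> by simp
    finally show "k \<in> {..2 ^ (3 * n)}" by (simp add: k)
  qed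
qed simp

lemma min_triangles_set_nonempty:
  assumes "1 \<le> t" "t \<le> n"
  shows "{num_triangles G | G. G \<in> tripartite_graphs n \<and> min_degree G \<ge> n + t} \<noteq> {}"
proof -
  define V where "V = {..<3 * n}"
  define E where "E = {{x, y} | x y. x \<in> V \<and> y \<in> V \<and> x div n \<noteq> y div n}"
  have n: "n > 0" using assms by simp
  have inE: "{x, y} \<in> E \<longleftrightarrow> x \<in> V \<and> y \<in> V \<and> x div n \<noteq> y div n" for x y
    unfolding E_def by (auto simp: doubleton_eq_iff)
  have simple: "simple_graph (V, E)"
    unfolding simple_graph_def by (auto simp: V_def E_def card_insert_if)
  have blk: "i * n \<le> x \<and> x < Suc i * n \<longleftrightarrow> x div n = i" for i x
  proof
    show "i * n \<le> x \<and> x < Suc i * n \<Longrightarrow> x div n = i"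
      by (rule div_nat_eqI) (auto simp: algebra_simps)
    show "x div n = i \<Longrightarrow> i * n \<le> x \<and> x < Suc i * n"
      using dividend_less_div_times[OF n, of x] by auto
  qed
  define P where "P i = {i * n..<Suc i * n}" for i
  have P: "x \<in> P i \<longleftrightarrow> x div n = i" for x i unfolding P_def using blk by auto
  have cP: "card (P i) = n" for i by (simp add: P_def)
  have VP: "V = P 0 \<union> P 1 \<union> P 2" unfolding V_def P_def by auto
  have ind: "independent_in (V, E) (P i)" for i
    unfolding independent_in_def by (auto simp: inE P)
  have tri: "(V, E) \<in> tripartite_graphs n"
    unfolding tripartite_graphs_def mem_Collect_eq
    by (intro conjI simple exI[of _ "P 0"] exI[of _ "P 1"] exI[of _ "P 2"] ind cP)
       (auto simp: VP P)
  have deg: "degree (V, E) v \<ge> n + t" if v: "v \<in> V" for v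
  proof -
    have eq: "{w \<in> V. {v, w} \<in> E} = V - P (v div n)" using v by (auto simp: inE P)
    have "card (V - P (v div n)) \<ge> card V - card (P (v div n))"
      by (rule diff_card_le_card_Diff) (simp add: P_def)
    then show ?thesis unfolding degree_def fst_conv snd_conv eq cP
      using assms by (simp add: V_def)
  qed
  have "min_degree (V, E) \<ge> n + t"
    unfolding min_degree_def
    by (subst Min_ge_iff) (use deg n in \<open>auto simp: V_def lessThan_empty_iff\<close>)
  with tri show ?thesis by blast
qed

end

theory Submission imports Defs begin

text \<open>Let \<open>t \<le> p \<le> 2 t\<close>. Split the parts as \<open>X \<union> Y' \<union> Z\<close>, \<open>X' \<union> Y \<union> Z'\<close> and \<open>P \<union> P' \<union> Q\<close>, where
  \<open>X, X'\<close> have \<open>p + t\<close> vertices, \<open>Y, Y'\<close> have \<open>t\<close> and \<open>P, P'\<close> have \<open>p\<close>. Join completely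
  \<open>X\<close> to \<open>X' \<union> Z' \<union> P\<close>, \<open>X'\<close> to \<open>Z \<union> P'\<close>, \<open>Z\<close> to \<open>P \<union> Q\<close>, \<open>Z'\<close> to \<open>P' \<union> Q\<close>, and \<open>Y\<close> and \<open>Y'\<close>
  to the whole third part; between \<open>X\<close> and \<open>Y\<close>, and between \<open>X'\<close> and \<open>Y'\<close>, put a sparsest
  bipartite graph with degrees at least \<open>2 t - p\<close> on the \<open>X\<close> side and at least \<open>t\<close> on the
  \<open>Y\<close> side. It has \<open>max (t\<^sup>2) ((p + t) (2 t - p))\<close> edges. Each of these lies in
  exactly \<open>p\<close> triangles, with apex in \<open>P\<close> respectively \<open>P'\<close>, and there are no other triangles.
  The two arguments of the maximum agree at \<open>p = \<phi> t\<close>; rounding this value down by \<open>x\<close>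
  costs at most \<open>(\<phi> + 1) x t\<^sup>2\<close>, rounding up by \<open>1 - x\<close> costs \<open>(1 - x) t\<^sup>2\<close>.\<close>

section \<open>Sparse bipartite graphs with prescribed minimum degrees\<close>

text \<open>Deal out \<open>b * c\<close> edges: edge \<open>k\<close> gets right end
  \<open>k div c\<close>, so each right vertex owns a block of \<open>c\<close> consecutive numbers,
  and left end \<open>k mod a\<close>, running cyclically. Since \<open>c \<le> a\<close>, a block
  meets each left vertex at most once; since \<open>a * d \<le> b * c\<close>, each left vertex
  comes up at least \<open>d\<close> times.\<close>

lemma ex_sparse_bipartite:
  fixes a b c d :: nat
  assumes "c \<le> a" "a * d \<le> b * c"
  obtains B where "B \<subseteq> {..<a} \<times> {..<b}" "card B \<le> b * c"
    "\<And>i. i < a \<Longrightarrow> d \<le> card {j. (i, j) \<in> B}"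
    "\<And>j. j < b \<Longrightarrow> c \<le> card {i. (i, j) \<in> B}"
proof
  let ?f = "\<lambda>k. (k mod a, k div c)"
  let ?B = "?f ` {..<b * c}"
  have cpos: "c > 0" if "k < b * c" for k using that by (cases c) auto
  have div_less: "k div c < b" if "k < b * c" for k
    using that cpos[OF that] by (simp add: div_less_iff_less_mult)
  show sub: "?B \<subseteq> {..<a} \<times> {..<b}"
  proof clarify
    fix k assume k: "k < b * c"
    show "k mod a \<in> {..<a} \<and> k div c \<in> {..<b}"
      using cpos[OF k] div_less[OF k] assms(1) by simp
  qed
  show "card ?B \<le> b * c" using card_image_le[of "{..<b * c}" ?f] by simp
  fix i assume i: "i < a"
  show "d \<le> card {j. (i, j) \<in> ?B}"
  proof (cases "d = 0")
    case False
    \<comment> \<open>The numbers \<open>i + m * a\<close> are the occurrences of residue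
      \<open>i\<close>; \<open>?g m\<close> is the block containing the \<open>m\<close>-th one.
      Steps of length \<open>a \<ge> c\<close> always reach a later block, so these right ends are
      distinct.\<close>
    let ?g = "\<lambda>m. (i + m * a) div c"
    have less: "i + m * a < b * c" if "m < d" for m
    proof -
      have "i + m * a < Suc m * a" using i by simp
      also have "\<dots> \<le> d * a" by (rule mult_le_mono1) (use that in simp)
      finally show ?thesis using assms(2) by (simp add: mult.commute)
    qed
    have c0: "c > 0" using less[of 0] False cpos by blast
    have "strict_mono ?g"
      unfolding strict_mono_Suc_iff
    proof
      fix m
      have "?g m < ?g m + 1" by simp
      also have "\<dots> = (i + m * a + c) div c" using c0 by simp
      also have "\<dots> \<le> ?g (Suc m)" by (rule div_le_mono) (use assms(1) in simp)
      finally show "?g m < ?g (Suc m)" .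
    qed
    then have "card (?g ` {..<d}) = d"
      by (simp add: card_image strict_mono_imp_inj_on inj_on_subset)
    moreover have "?g ` {..<d} \<subseteq> {j. (i, j) \<in> ?B}"
    proof clarify
      fix m assume "m < d"
      then show "(i, ?g m) \<in> ?B" using less[of m] i
        by (intro image_eqI[of _ _ "i + m * a"]) auto
    qed
    moreover have "finite {j. (i, j) \<in> ?B}"
      by (rule finite_subset[of _ "{..<b}"]) (use sub in auto)
    ultimately show ?thesis using card_mono by metis
  qed simp
next
  let ?f = "\<lambda>k. (k mod a, k div c)"
  let ?B = "?f ` {..<b * c}"
  fix j assume j: "j < b"
  let ?g = "\<lambda>m. (j * c + m) mod a"
  have "inj_on ?g {..<c}"
  proof (rule linorder_inj_onI)
    fix x y assume xy: "x < y" "x \<in> {..<c}" "y \<in> {..<c}"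
    show "?g x \<noteq> ?g y"
    proof
      assume "?g x = ?g y"
      then have "a dvd (j * c + y) - (j * c + x)"
        using mod_eq_dvd_iff_nat[of "j * c + x" "j * c + y" a] xy by simp
      then have "a dvd y - x" by simp
      then show False using xy assms(1) dvd_imp_le[of a "y - x"] by auto
    qed
  qed auto
  then have "card (?g ` {..<c}) = c" by (simp add: card_image)
  moreover have "?g ` {..<c} \<subseteq> {i. (i, j) \<in> ?B}"
  proof clarify
    fix m assume m: "m < c"
    have "j * c + m < Suc j * c" using m by simp
    also have "\<dots> \<le> b * c" by (rule mult_le_mono1) (use j in simp)
    finally show "(?g m, j) \<in> ?B" using m
      by (intro image_eqI[of _ _ "j * c + m"]) auto
  qed
  moreover have "finite {i. (i, j) \<in> ?B}"
    by (rule finite_subset[of _ "fst ` ?B"]) force+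
  ultimately show "c \<le> card {i. (i, j) \<in> ?B}" using card_mono by metis
qed

section \<open>From three bipartite relations to a tripartite graph\<close>

text \<open>Reduces a construction to counting with indices below \<open>n\<close> in each part: the
  graph lives on \<open>{..<3 * n}\<close>, with the parts shifted by \<open>0\<close>,
  \<open>n\<close> and \<open>2 * n\<close>.\<close>

lemma min_triangles_le:
  fixes n t M :: nat and R S T :: "nat \<Rightarrow> nat \<Rightarrow> bool"
  assumes n: "n > 0"
    and deg1: "\<And>i. i < n \<Longrightarrow> n + t \<le> card {j. j < n \<and> R i j} + card {k. k < n \<and> S i k}"
    and deg2: "\<And>j. j < n \<Longrightarrow> n + t \<le> card {i. i < n \<and> R i j} + card {k. k < n \<and> T j k}"
    and deg3: "\<And>k. k < n \<Longrightarrow> n + t \<le> card {i. i < n \<and> S i k} + card {j. j < n \<and> T j k}"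
    and tri: "card {(i, j, k). i < n \<and> j < n \<and> k < n \<and> R i j \<and> S i k \<and> T j k} \<le> M"
  shows "min_triangles n t \<le> M"
proof -
  \<comment> \<open>Every edge is oriented from its smaller to its larger end, hence from an earlier
    part to a later one.\<close>
  define adj where "adj x y \<longleftrightarrow>
      x < n \<and> n \<le> y \<and> y < 2 * n \<and> R x (y - n)
    \<or> x < n \<and> 2 * n \<le> y \<and> y < 3 * n \<and> S x (y - 2 * n)
    \<or> n \<le> x \<and> x < 2 * n \<and> 2 * n \<le> y \<and> y < 3 * n \<and> T (x - n) (y - 2 * n)" for x y
  define V where "V = {..<3 * n}"
  define E where "E = {{x, y} | x y. adj x y}"
  have inE: "{x, y} \<in> E \<longleftrightarrow> adj x y \<or> adj y x" for x y
    unfolding E_def by (auto simp: doubleton_eq_iff)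
  have adj_less: "adj x y \<Longrightarrow> x < y \<and> y < 3 * n" for x y
    unfolding adj_def by auto
  have simple: "simple_graph (V, E)"
    unfolding simple_graph_def E_def using adj_less by (fastforce simp: V_def card_insert_if)
  have trip: "(V, E) \<in> tripartite_graphs n"
    unfolding tripartite_graphs_def mem_Collect_eq
    by (intro conjI simple exI[of _ "{..<n}"] exI[of _ "{n..<2 * n}"] exI[of _ "{2 * n..<3 * n}"])
       (auto simp: V_def independent_in_def inE adj_def)
  have deg_ge: "card A + card B \<le> degree (V, E) v"
    if "inj_on f A" "inj_on g B" "f ` A \<inter> g ` B = {}" "f ` A \<subseteq> {w \<in> V. {v, w} \<in> E}"
      "g ` B \<subseteq> {w \<in> V. {v, w} \<in> E}" for A B v and f g :: "nat \<Rightarrow> nat"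
  proof -
    have fin: "finite {w \<in> V. {v, w} \<in> E}" by (simp add: V_def)
    have "card A + card B = card (f ` A \<union> g ` B)"
      using that fin by (subst card_Un_disjoint) (auto simp: card_image intro: finite_subset)
    also have "\<dots> \<le> degree (V, E) v"
      unfolding degree_def using that fin by (auto intro!: card_mono)
    finally show ?thesis .
  qed
  have deg: "n + t \<le> degree (V, E) v" if v: "v \<in> V" for v
  proof -
    consider "v < n" | "n \<le> v" "v < 2 * n" | "2 * n \<le> v" "v < 3 * n"
      using v by (force simp: V_def)
    then show ?thesis
    proof cases
      case 1
      have "card {j. j < n \<and> R v j} + card {k. k < n \<and> S v k} \<le> degree (V, E) v"
        by (rule deg_ge[of "\<lambda>j. n + j" _ "\<lambda>k. 2 * n + k"])
           (use 1 in \<open>auto simp: V_def inE adj_def inj_on_def\<close>)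
      with deg1[OF 1] show ?thesis by linarith
    next
      case 2
      have "card {i. i < n \<and> R i (v - n)} + card {k. k < n \<and> T (v - n) k} \<le> degree (V, E) v"
        by (rule deg_ge[of "\<lambda>i. i" _ "\<lambda>k. 2 * n + k"])
           (use 2 in \<open>auto simp: V_def inE adj_def inj_on_def\<close>)
      with deg2[of "v - n"] 2 show ?thesis by linarith
    next
      case 3
      have "card {i. i < n \<and> S i (v - 2 * n)} + card {j. j < n \<and> T j (v - 2 * n)}
          \<le> degree (V, E) v"
        by (rule deg_ge[of "\<lambda>i. i" _ "\<lambda>j. n + j"])
           (use 3 in \<open>auto simp: V_def inE adj_def inj_on_def\<close>)
      with deg3[of "v - 2 * n"] 3 show ?thesis by linarith
    qed
  qed
  have mind: "n + t \<le> min_degree (V, E)"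
    unfolding min_degree_def
    by (subst Min_ge_iff) (use deg n in \<open>auto simp: V_def lessThan_empty_iff\<close>)
  let ?I = "{(i, j, k). i < n \<and> j < n \<and> k < n \<and> R i j \<and> S i k \<and> T j k}"
  have finI: "finite ?I"
    by (rule finite_subset[of _ "{..<n} \<times> {..<n} \<times> {..<n}"]) auto
  have "triangles (V, E) \<subseteq> (\<lambda>(i, j, k). {i, n + j, 2 * n + k}) ` ?I"
  proof
    fix U assume "U \<in> triangles (V, E)"
    then have U: "card U = 3" "\<And>x y. x \<in> U \<Longrightarrow> y \<in> U \<Longrightarrow> x \<noteq> y \<Longrightarrow> {x, y} \<in> E"
      by (auto simp: triangles_def)
    obtain x y z where xyz: "x < y" "y < z" "U = {x, y, z}"
    proof -
      obtain a b c where abc: "U = {a, b, c}" "a \<noteq> b" "a \<noteq> c" "b \<noteq> c"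
        using U(1) by (auto simp: card_3_iff)
      show ?thesis
        using abc that[of a b c] that[of a c b] that[of b a c] that[of b c a]
          that[of c a b] that[of c b a]
        by (elim linorder_neqE_nat) (simp_all add: insert_commute)
    qed
    have adjI: "adj v w" if "v \<in> U" "w \<in> U" "v < w" for v w
      using U(2)[OF that(1,2)] adj_less[of w v] that(3) by (auto simp: inE)
    have "adj x y" "adj x z" "adj y z"
      using xyz by (simp_all add: adjI)
    \<comment> \<open>As \<open>y\<close> is the head of one oriented edge and the tail of another,
      it lies in the middle part; this forces \<open>x\<close> into the first part and
      \<open>z\<close> into the last.\<close>
    then have "(x, y - n, z - 2 * n) \<in> ?I" "n \<le> y" "2 * n \<le> z"
      unfolding adj_def by auto
    then show "U \<in> (\<lambda>(i, j, k). {i, n + j, 2 * n + k}) ` ?I"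
      using xyz by (intro image_eqI[of _ _ "(x, y - n, z - 2 * n)"]) auto
  qed
  then have "num_triangles (V, E) \<le> card ?I"
    unfolding num_triangles_def using surj_card_le[OF finI] by blast
  moreover have "min_triangles n t \<le> num_triangles (V, E)"
    unfolding min_triangles_def
    by (rule Min_le[OF finite_min_triangles_set]) (use trip mind in blast)
  ultimately show ?thesis using tri by linarith
qed

section \<open>The construction for a given \<open>p\<close>\<close>

lemma min_triangles_le_construction:
  fixes n t p :: nat
  assumes "t \<ge> 1" "t \<le> p" "p \<le> 2 * t" "3 * t + 2 * p \<le> n"
  shows "min_triangles n t \<le> 2 * (p * max (t\<^sup>2) ((p + t) * (2 * t - p)))"
proof -
  define s where "s = p + t"
  define M where "M = max (t\<^sup>2) (s * (2 * t - p))"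
  obtain B where B: "B \<subseteq> {..<s} \<times> {..<t}" "card B \<le> M"
    and B1: "\<And>i. i < s \<Longrightarrow> 2 * t - p \<le> card {j. (i, j) \<in> B}"
    and B2: "\<And>j. j < t \<Longrightarrow> t \<le> card {i. (i, j) \<in> B}"
  \<comment> \<open>The larger of the two degree sums dictates the number of edges, and its side
    must play the role of the blocks in \<open>ex_sparse_bipartite\<close>. If that is the
    \<open>X\<close> side, the graph is built with sides swapped and then reversed; there
    \<open>t \<le> p\<close> gives \<open>2 * t - p \<le> t\<close>.\<close>
  proof (cases "s * (2 * t - p) \<le> t * t")
    case True
    then show ?thesis
      using ex_sparse_bipartite[of t s "2 * t - p" t] that
      by (metis M_def le_add2 max.absorb1 power2_eq_square s_def)
  next
    case False
    obtain C where C: "C \<subseteq> {..<t} \<times> {..<s}" "card C \<le> s * (2 * t - p)"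
      "\<And>i. i < t \<Longrightarrow> t \<le> card {j. (i, j) \<in> C}"
      "\<And>j. j < s \<Longrightarrow> 2 * t - p \<le> card {i. (i, j) \<in> C}"
      by (rule ex_sparse_bipartite[of "2 * t - p" t t s]) (use False assms in auto)
    show ?thesis
      by (rule that[of "C\<inverse>"]) (use C in \<open>auto simp: M_def\<close>)
  qed
  have finB: "finite B" using B(1) by (rule finite_subset) simp
  \<comment> \<open>Vertices of each part are numbered from 0 in the order \<open>X, Y', Z\<close>; \<open>X', Y, Z'\<close>; \<open>P, P', Q\<close>.
    With this order \<open>R\<close> is symmetric.\<close>
  define R where "R i j \<longleftrightarrow> i < s \<and> (j < s \<or> s + t \<le> j) \<or> s + t \<le> i \<and> j < s
    \<or> s \<le> j \<and> (i, j - s) \<in> B \<or> s \<le> i \<and> (j, i - s) \<in> B" for i j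
  define S where "S i k \<longleftrightarrow> i < s \<and> k < p \<or> s \<le> i \<and> i < s + t
    \<or> s + t \<le> i \<and> (k < p \<or> 2 * p \<le> k)" for i k
  define T where "T j k \<longleftrightarrow> j < s \<and> p \<le> k \<and> k < 2 * p \<or> s \<le> j \<and> j < s + t
    \<or> s + t \<le> j \<and> p \<le> k" for j k
  have R_sym: "R i j \<longleftrightarrow> R j i" for i j unfolding R_def by auto
  have s_le: "s + t \<le> n" using assms by (simp add: s_def)
  have sub: "card A \<le> card {x. x < n \<and> Q x}" if "\<And>x. x \<in> A \<Longrightarrow> x < n \<and> Q x" for A Q
    by (rule card_mono) (use that in auto)
  have deg_R: "(if i < s then n + t - p else if i < s + t then t else s)
      \<le> card {j. j < n \<and> R i j}" (is "?d \<le> _") if "i < n" for i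
  proof -
    consider "i < s" | "s \<le> i" "i < s + t" | "s + t \<le> i" by linarith
    then show ?thesis
    proof cases
      case 1
      let ?J = "(+) s ` {j. (i, j) \<in> B}"
      have J: "?J \<subseteq> {s..<s + t}" using B(1) by auto
      have finJ: "finite ?J" using J by (rule finite_subset) simp
      have disj: "{..<s} \<inter> ?J = {}" "({..<s} \<union> ?J) \<inter> {s + t..<n} = {}" using J by force+
      have J_R: "j < n \<and> R i j" if "j \<in> ?J" for j
        using that J s_le by (auto simp: R_def)
      have "?d \<le> s + card {j. (i, j) \<in> B} + (n - (s + t))"
        using B1[OF 1] 1 assms by (simp add: s_def)
      also have "\<dots> = card {..<s} + card ?J + card {s + t..<n}"
        by (simp add: card_image)
      also have "card {..<s} + card ?J = card ({..<s} \<union> ?J)"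
        using finJ disj by (subst card_Un_disjoint) auto
      also have "\<dots> + card {s + t..<n} = card ({..<s} \<union> ?J \<union> {s + t..<n})"
        using finJ disj by (subst card_Un_disjoint) auto
      also have "\<dots> \<le> card {j. j < n \<and> R i j}"
        proof (rule sub)
          fix j assume "j \<in> {..<s} \<union> ?J \<union> {s + t..<n}"
          then consider "j < s" | "j \<in> ?J" | "s + t \<le> j" "j < n" by fastforce
          then show "j < n \<and> R i j"
            using 1 s_le J_R by cases (auto simp: R_def)
        qed
      finally show ?thesis .
    next
      case 2
      have "?d \<le> card {j. (j, i - s) \<in> B}" using B2[of "i - s"] 2 by simp
      also have "\<dots> \<le> card {j. j < n \<and> R i j}"
        by (rule sub) (use 2 B(1) s_le in \<open>auto simp: R_def\<close>)
      finally show ?thesis .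
    next
      case 3
      then have "?d = card {..<s}" by simp
      also have "\<dots> \<le> card {j. j < n \<and> R i j}"
        by (rule sub) (use 3 s_le in \<open>auto simp: R_def\<close>)
      finally show ?thesis .
    qed
  qed
  have p_le: "2 * p \<le> n" using assms by simp
  have deg_S: "(if i < s then p else if i < s + t then n else n - p)
      \<le> card {k. k < n \<and> S i k}" (is "?d \<le> _") for i
  proof -
    consider "i < s" | "s \<le> i" "i < s + t" | "s + t \<le> i" by linarith
    then show ?thesis
    proof cases
      case 1
      then show ?thesis using sub[of "{..<p}" "S i"] p_le by (auto simp: S_def)
    next
      case 2
      then show ?thesis using sub[of "{..<n}" "S i"] by (auto simp: S_def)
    next
      case 3
      have "?d = card ({..<p} \<union> {2 * p..<n})"
        using 3 p_le by (subst card_Un_disjoint) auto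
      also have "\<dots> \<le> card {k. k < n \<and> S i k}"
        by (rule sub) (use 3 p_le in \<open>auto simp: S_def\<close>)
      finally show ?thesis .
    qed
  qed
  have deg_T: "(if j < s then p else if j < s + t then n else n - p)
      \<le> card {k. k < n \<and> T j k}" for j
  proof -
    consider "j < s" | "s \<le> j" "j < s + t" | "s + t \<le> j" by linarith
    then show ?thesis
    proof cases
      case 1
      then show ?thesis using sub[of "{p..<2 * p}" "T j"] p_le by (auto simp: T_def)
    next
      case 2
      then show ?thesis using sub[of "{..<n}" "T j"] by (auto simp: T_def)
    next
      case 3
      then show ?thesis using sub[of "{p..<n}" "T j"] by (auto simp: T_def)
    qed
  qed
  \<comment> \<open>In the first two parts the bounds of \<open>deg_R\<close> and of
    \<open>deg_S\<close> or \<open>deg_T\<close> add up to exactly \<open>n + t\<close> for each of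
    the three vertex types.\<close>
  have bal: "n + t \<le> (if i < s then n + t - p else if i < s + t then t else s)
      + (if i < s then p else if i < s + t then n else n - p)" for i
    using assms by (simp add: s_def)
  have "min_triangles n t \<le> 2 * (p * M)"
  proof (rule min_triangles_le[of n t R S T])
    show "n > 0" using assms by simp
  next
    fix i assume "i < n"
    then show "n + t \<le> card {j. j < n \<and> R i j} + card {k. k < n \<and> S i k}"
      using deg_R[of i] deg_S[of i] bal[of i] by linarith
  next
    fix j assume "j < n"
    moreover have "{i. i < n \<and> R i j} = {i. i < n \<and> R j i}" using R_sym by auto
    ultimately show "n + t \<le> card {i. i < n \<and> R i j} + card {k. k < n \<and> T j k}"
      using deg_R[of j] deg_T[of j] bal[of j] by simp
  next
    fix k assume "k < n"
    consider "k < p" | "p \<le> k" "k < 2 * p" | "2 * p \<le> k" by linarith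
    then show "n + t \<le> card {i. i < n \<and> S i k} + card {j. j < n \<and> T j k}"
    proof cases
      case 1
      have "card {..<n} \<le> card {i. i < n \<and> S i k}"
        by (rule sub) (use 1 in \<open>auto simp: S_def\<close>)
      moreover have "card {s..<s + t} \<le> card {j. j < n \<and> T j k}"
        by (rule sub) (use s_le in \<open>auto simp: T_def\<close>)
      ultimately show ?thesis by simp
    next
      case 2
      have "card {..<n} \<le> card {j. j < n \<and> T j k}"
        by (rule sub) (use 2 in \<open>auto simp: T_def\<close>)
      moreover have "card {s..<s + t} \<le> card {i. i < n \<and> S i k}"
        by (rule sub) (use s_le in \<open>auto simp: S_def\<close>)
      ultimately show ?thesis by simp
    next
      \<comment> \<open>A vertex of \<open>Q\<close> has \<open>2 * (n - s)\<close> neighbours; this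
        is where \<open>3 * t + 2 * p \<le> n\<close> is the exact condition.\<close>
      case 3
      have "card {s..<n} \<le> card {i. i < n \<and> S i k}"
        by (rule sub) (use 3 in \<open>auto simp: S_def\<close>)
      moreover have "card {s..<n} \<le> card {j. j < n \<and> T j k}"
        by (rule sub) (use 3 in \<open>auto simp: T_def\<close>)
      ultimately show ?thesis using assms by (simp add: s_def)
    qed
  next
    let ?f = "\<lambda>((x, y), k). (x, s + y, k)" and ?g = "\<lambda>((x, y), k). (s + y, x, k)"
    have "{(i, j, k). i < n \<and> j < n \<and> k < n \<and> R i j \<and> S i k \<and> T j k}
        \<subseteq> ?f ` (B \<times> {..<p}) \<union> ?g ` (B \<times> {p..<2 * p})" (is "?I \<subseteq> ?U")
    proof clarify
      fix i j k assume ijk: "R i j" "S i k" "T j k" "(i, j, k) \<notin> ?g ` (B \<times> {p..<2 * p})"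
      \<comment> \<open>In the first two cases the edge is not from \<open>B\<close>: one end sees
        nothing of \<open>P'\<close> and the other nothing outside \<open>P'\<close>, or likewise
        for \<open>P\<close>, so there is no common apex.\<close>
      from ijk(1) consider "i < s" "j < s \<or> s + t \<le> j" | "s + t \<le> i" "j < s"
        | "s \<le> j" "(i, j - s) \<in> B" | "s \<le> i" "(j, i - s) \<in> B"
        unfolding R_def by blast
      then show "(i, j, k) \<in> ?f ` (B \<times> {..<p})"
      proof cases
        case 1
        then show ?thesis using ijk(2,3) by (auto simp: S_def T_def)
      next
        case 2
        then show ?thesis using ijk(2,3) by (auto simp: S_def T_def)
      next
        case 3
        then have "k < p" using ijk(2) B(1) by (auto simp: S_def)
        with 3 show ?thesis by (intro image_eqI[of _ _ "((i, j - s), k)"]) auto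
      next
        case 4
        then have "p \<le> k" "k < 2 * p" using ijk(3) B(1) by (auto simp: T_def)
        with 4 have "(i, j, k) \<in> ?g ` (B \<times> {p..<2 * p})"
          by (intro image_eqI[of _ _ "((j, i - s), k)"]) auto
        with ijk(4) show ?thesis by blast
      qed
    qed
    then have "card ?I \<le> card ?U" by (rule card_mono[rotated]) (use finB in simp)
    also have "\<dots> \<le> card (?f ` (B \<times> {..<p})) + card (?g ` (B \<times> {p..<2 * p}))"
      by (rule card_Un_le)
    also have "\<dots> \<le> card (B \<times> {..<p}) + card (B \<times> {p..<2 * p})"
      by (intro add_mono card_image_le) (use finB in auto)
    also have "\<dots> = 2 * (p * card B)" by (simp add: card_cartesian_product)
    also have "\<dots> \<le> 2 * (p * M)" using B(2) by simp
    finally show "card ?I \<le> 2 * (p * M)" .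
  qed
  then show ?thesis by (simp add: M_def s_def)
qed

section \<open>Estimates near the golden ratio\<close>

lemma golden_ratio_square: "golden_ratio\<^sup>2 = golden_ratio + 1"
  by (simp add: golden_ratio_def power_divide power2_sum)

lemma golden_ratio_bounds: "1 < golden_ratio" "golden_ratio < 2"
proof -
  show "1 < golden_ratio" using real_less_rsqrt[of 1 5] by (simp add: golden_ratio_def)
  show "golden_ratio < 2" using real_less_lsqrt[of 3 5] by (simp add: golden_ratio_def)
qed

text \<open>The difference of the two arguments of the maximum is a quadratic in \<open>p\<close>
  with roots \<open>golden_ratio * t\<close> and \<open>(1 - golden_ratio) * t\<close>, so from the
  larger root on the maximum is \<open>t\<^sup>2\<close>.\<close>

lemma cubic_le_above:
  fixes p t :: real
  assumes "0 < t" "golden_ratio * t \<le> p"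
  shows "p * max (t\<^sup>2) ((p + t) * (2 * t - p)) \<le> p * t\<^sup>2"
proof -
  have "0 < golden_ratio * t" using assms(1) golden_ratio_bounds(1) by simp
  with assms(2) have p: "0 \<le> p" by linarith
  have "t\<^sup>2 - (p + t) * (2 * t - p)
      = (p - golden_ratio * t) * (p + golden_ratio * t - t) + (golden_ratio\<^sup>2 - golden_ratio - 1) * t\<^sup>2"
    by (simp add: algebra_simps power2_eq_square)
  also have "\<dots> = (p - golden_ratio * t) * (p + (golden_ratio - 1) * t)"
    by (simp add: golden_ratio_square algebra_simps)
  also have "\<dots> \<ge> 0"
    by (intro mult_nonneg_nonneg add_nonneg_nonneg) (use assms p golden_ratio_bounds in auto)
  finally show ?thesis using p by (intro mult_left_mono) auto
qed

lemma cubic_le_below: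
  fixes x t :: real
  assumes "1 \<le> t" "0 \<le> x" "x \<le> 1"
  defines "p \<equiv> golden_ratio * t - x"
  shows "p * max (t\<^sup>2) ((p + t) * (2 * t - p))
    \<le> golden_ratio * t ^ 3 + (golden_ratio + 1) * x * t\<^sup>2"
proof -
  define g where "g = golden_ratio"
  have g: "1 < g" "g < 2" "g * g = g + 1"
    using golden_ratio_bounds golden_ratio_square by (auto simp: g_def power2_eq_square)
  have "p * t\<^sup>2 \<le> g * t ^ 3 + (g + 1) * x * t\<^sup>2"
  proof -
    have "p * t\<^sup>2 \<le> g * t * t\<^sup>2"
      by (rule mult_right_mono) (use assms in \<open>auto simp: g_def\<close>)
    moreover have "0 \<le> (g + 1) * x * t\<^sup>2" using g assms by simp
    ultimately show ?thesis by (simp add: power3_eq_cube power2_eq_square)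
  qed
  moreover have "p * ((p + t) * (2 * t - p)) \<le> g * t ^ 3 + (g + 1) * x * t\<^sup>2"
  proof -
    \<comment> \<open>Taylor expansion in \<open>x\<close> about \<open>golden_ratio * t\<close>.
      The last summand vanishes for the golden ratio; including it makes this a polynomial identity
      in \<open>g\<close>.\<close>
    have "p * ((p + t) * (2 * t - p))
        = g * t ^ 3 + (g + 1) * x * t\<^sup>2 - x\<^sup>2 * ((3 * g - 1) * t - x)
          - (g * g - g - 1) * (g * t ^ 3 - 3 * x * t\<^sup>2)"
      unfolding p_def g_def by algebra
    moreover have "0 \<le> x\<^sup>2 * ((3 * g - 1) * t - x)"
    proof -
      have "1 * 1 \<le> (3 * g - 1) * t" by (rule mult_mono) (use g assms in auto)
      then show ?thesis using assms by simp
    qed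
    ultimately show ?thesis using g by simp
  qed
  ultimately show ?thesis by (simp add: g_def max_def)
qed

section \<open>Choosing the better rounding\<close>

theorem theorem1p3:
  fixes n t :: nat
  assumes "t \<ge> 1"
    and "int n \<ge> 3 * int t + 2 * \<lceil>golden_ratio * real t\<rceil>"
  shows "int (min_triangles n t) \<le>
           2 * (MIN p \<in> {\<lfloor>golden_ratio * real t\<rfloor>, \<lceil>golden_ratio * real t\<rceil>}.
                  p * max ((int t)\<^sup>2) ((p + int t) * (2 * int t - p)))
       \<and> real_of_int
           (2 * (MIN p \<in> {\<lfloor>golden_ratio * real t\<rfloor>, \<lceil>golden_ratio * real t\<rceil>}.
                  p * max ((int t)\<^sup>2) ((p + int t) * (2 * int t - p))))
         \<le> (1 + sqrt 5) * real t ^ 3 + (1 + 1 / sqrt 5) * (real t)\<^sup>2"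
proof -
  define a where "a = \<lfloor>golden_ratio * real t\<rfloor>"
  define b where "b = \<lceil>golden_ratio * real t\<rceil>"
  define F where "F p = p * max ((int t)\<^sup>2) ((p + int t) * (2 * int t - p))" for p
  define G where "G p = p * max ((real t)\<^sup>2) ((p + real t) * (2 * real t - p))" for p
  have FG: "real_of_int (F p) = G (real_of_int p)" for p
    by (simp add: F_def G_def of_int_max)
  have MIN: "(MIN p \<in> {a, b}. F p) = min (F a) (F b)" by simp
  have t: "1 \<le> real t" using assms(1) by simp
  have ab: "int t \<le> a" "a \<le> b" "b \<le> 2 * int t" "b \<le> a + 1"
    using golden_ratio_bounds t ceiling_diff_floor_le_1[of "golden_ratio * real t"]
    by (auto simp: a_def b_def le_floor_iff ceiling_le_iff intro: floor_le_ceiling)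
  \<comment> \<open>By \<open>ab\<close> both roundings lie between \<open>t\<close> and
    \<open>2 * t\<close>, and the hypothesis on \<open>n\<close>, stated for the ceiling, covers the
    floor too.\<close>
  have upper: "int (min_triangles n t) \<le> 2 * F p" if "p \<in> {a, b}" for p
  proof -
    define q where "q = nat p"
    have p: "p = int q" "t \<le> q" "q \<le> 2 * t" "3 * t + 2 * q \<le> n"
      using that ab assms(2) unfolding q_def b_def[symmetric] by auto
    have "int (min_triangles n t) \<le> int (2 * (q * max (t\<^sup>2) ((q + t) * (2 * t - q))))"
      using min_triangles_le_construction[of t q n] p assms(1) by (intro of_nat_mono) auto
    also have "\<dots> = 2 * F p"
      using p by (simp add: F_def of_nat_max of_nat_diff)
    finally show ?thesis .
  qed
  have "2 * real_of_int (min (F a) (F b))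
      \<le> (1 + sqrt 5) * real t ^ 3 + (1 + 1 / sqrt 5) * (real t)\<^sup>2"
  proof -
    define x where "x = golden_ratio * real t - a"
    have x: "0 \<le> x" "x \<le> 1" unfolding x_def a_def by linarith+
    have sq: "sqrt 5 * sqrt 5 = 5" "sqrt 5 > 0" by simp_all
    have bal: "(golden_ratio + 2) * (1 + 1 / sqrt 5) = 2 * (golden_ratio + 1)"
      by (simp add: golden_ratio_def field_simps)
    have Ga: "G a \<le> golden_ratio * real t ^ 3 + (golden_ratio + 1) * x * (real t)\<^sup>2"
      using cubic_le_below[OF t x] by (simp add: G_def x_def)
    have Gb: "G b \<le> golden_ratio * real t ^ 3 + (1 - x) * (real t)\<^sup>2"
    proof -
      have "G b \<le> b * (real t)\<^sup>2"
        unfolding G_def by (rule cubic_le_above) (use t in \<open>auto simp: b_def\<close>)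
      also have "\<dots> \<le> (golden_ratio * real t + (1 - x)) * (real t)\<^sup>2"
        by (rule mult_right_mono) (use ab in \<open>simp_all add: x_def\<close>)
      finally show ?thesis by (simp add: algebra_simps power3_eq_cube power2_eq_square)
    qed
    \<comment> \<open>The two excess terms agree at \<open>x = 1 / (golden_ratio + 2)\<close>.\<close>
    have "2 * min ((golden_ratio + 1) * x) (1 - x) \<le> 1 + 1 / sqrt 5"
    proof -
      define m where "m = min ((golden_ratio + 1) * x) (1 - x)"
      \<comment> \<open>Adding these two bounds, the second weighted by
        \<open>golden_ratio + 1\<close>, eliminates \<open>x\<close>.\<close>
      have "m \<le> (golden_ratio + 1) * x" "(golden_ratio + 1) * m \<le> (golden_ratio + 1) * (1 - x)"
        using golden_ratio_bounds by (auto simp: m_def intro!: mult_left_mono)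
      then have "(golden_ratio + 2) * (2 * m) \<le> (golden_ratio + 2) * (1 + 1 / sqrt 5)"
        unfolding bal by (simp add: algebra_simps)
      then show ?thesis
        using golden_ratio_bounds by (subst (asm) mult_le_cancel_left_pos) (auto simp: m_def)
    qed
    then have "2 * min ((golden_ratio + 1) * x) (1 - x) * (real t)\<^sup>2 \<le> (1 + 1 / sqrt 5) * (real t)\<^sup>2"
      by (rule mult_right_mono) simp
    moreover have "real_of_int (min (F a) (F b)) \<le> G a" "real_of_int (min (F a) (F b)) \<le> G b"
      unfolding FG[symmetric] of_int_le_iff by simp_all
    then have "real_of_int (min (F a) (F b))
        \<le> golden_ratio * real t ^ 3 + min ((golden_ratio + 1) * x) (1 - x) * (real t)\<^sup>2"
      using Ga Gb by (cases "(golden_ratio + 1) * x \<le> 1 - x") (simp_all add: min_def)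
    moreover have "2 * golden_ratio * real t ^ 3 = (1 + sqrt 5) * real t ^ 3"
      by (simp add: golden_ratio_def)
    ultimately show ?thesis by linarith
  qed
  moreover have "int (min_triangles n t) \<le> 2 * min (F a) (F b)"
    using upper[of a] upper[of b] by (simp add: min_def)
  ultimately show ?thesis
    using MIN unfolding a_def[symmetric] b_def[symmetric] F_def by simp
qed

end
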